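(* Let $L=(T,V,E)$ be a simple undirected link stream with durations. Then the algorithm described in the context terminates and returns exactly the set of all maximal cliques $(X,[x,y])$ of $L$ with $|X|\ge 2$.
   Context: A link stream with durations is a triplet $L=(T,V,E)$ where $T$ is a time interval, $V$ a finite set of nodes and $E\subseteq T\times T\times V\times V$ a finite set of links such that every link $(b,e,u,v)\in E$ satisfies $e\ge b$. It is undirected if $(b,e,u,v)$ and $(b,e,v,u)$ are not distinguished. It is simple if for all $(b,e,u,v)\in E$ we have $u\neq v$, and for any two distinct links $(b,e,u,v),(b',e',u,v)\in E$ on the same pair of nodes, $[b,e]\cap[b',e']=\emptyset$. A clique of $L$ is a pair $C=(X,[x,y])$ with $X\subseteq V$ and $[x,y]\subseteq T$ such that for every pair $\{u,v\}\subseteq X$ of distinct nodes there is a link $(b,e,u,v)\in E$ with $[x,y]\subseteq[b,e]$. A clique $C=(X,[x,y])$ is maximal if there is no clique $C'=(X',[x',y'])\neq C$ with $X\subseteq X'$ and $[x,y]\subseteq[x',y']$. The algorithm: Initialize sets $S=\emptyset$, $R=\emptyset$, $M=\emptyset$. For each link $(b,e,u,v)\in E$, add $(\{u,v\},[b,b])$ to $S$ and to $M$. While $S\neq\emptyset$: remove some element $(X,[x,y])$ from $S$; set isMax to True; for each $v\in V\setminus X$, if $(X\cup\{v\},[x,y])$ is a clique, set isMax to False and, if $(X\cup\{v\},[x,y])\notin M$, add it to $S$ and $M$. Then set $l=\min\{e : \exists (b,e,u,v)\in E \text{ with } u,v\in X,\ [x,y]\subseteq[b,e]\}$. If $l\neq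 y$, set isMax to False and, if $(X,[x,l])\notin M$, add $(X,[x,l])$ to $S$ and $M$. If isMax is still True, add $(X,[x,y])$ to $R$. When $S$ is empty, return $R$. *)

theory Defs
  imports "HOL-Analysis.Analysis"
begin

type_synonym 'v link = "real \<times> real \<times> 'v \<times> 'v"

definition link_stream :: "real set \<Rightarrow> 'v set \<Rightarrow> 'v link set \<Rightarrow> bool" where
  "link_stream T V E \<longleftrightarrow>
     is_interval T \<and> finite V \<and> finite E \<and> E \<subseteq> T \<times> T \<times> V \<times> V \<and>
     (\<forall>(b, e, u, v) \<in> E. b \<le> e)"

text \<open>Not distinguishing a link from its reversal is encoded by closing the set of links
  under reversal.\<close>

definition undirected :: "'v link set \<Rightarrow> bool" where
  "undirected E \<longleftrightarrow> (\<forall>b e u v. (b, e, u, v) \<in> E \<longleftrightarrow> (b, e, v, u) \<in> E)"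

definition simple :: "'v link set \<Rightarrow> bool" where
  "simple E \<longleftrightarrow>
     (\<forall>(b, e, u, v) \<in> E. u \<noteq> v) \<and>
     (\<forall>b e b' e' u v. (b, e, u, v) \<in> E \<longrightarrow> (b', e', u, v) \<in> E \<longrightarrow>
        (b, e) \<noteq> (b', e') \<longrightarrow> {b..e} \<inter> {b'..e'} = {})"

text \<open>The triple \<open>(X, x, y)\<close> stands for the pair \<open>(X, [x, y])\<close>. The condition \<open>x \<le> y\<close> in
  \<open>is_clique\<close> makes \<open>[x, y]\<close> a genuine (nonempty) interval, hence determined by, and
  determining, its end points.\<close>

type_synonym 'v timed_set = "'v set \<times> real \<times> real"

fun is_clique :: "real set \<Rightarrow> 'v set \<Rightarrow> 'v link set \<Rightarrow> 'v timed_set \<Rightarrow> bool" where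
  "is_clique T V E (X, x, y) \<longleftrightarrow>
     X \<subseteq> V \<and> x \<le> y \<and> {x..y} \<subseteq> T \<and>
     (\<forall>u\<in>X. \<forall>v\<in>X. u \<noteq> v \<longrightarrow> (\<exists>b e. (b, e, u, v) \<in> E \<and> {x..y} \<subseteq> {b..e}))"

fun is_maximal_clique :: "real set \<Rightarrow> 'v set \<Rightarrow> 'v link set \<Rightarrow> 'v timed_set \<Rightarrow> bool" where
  "is_maximal_clique T V E (X, x, y) \<longleftrightarrow>
     is_clique T V E (X, x, y) \<and>
     \<not> (\<exists>X' x' y'. is_clique T V E (X', x', y') \<and> (X', x', y') \<noteq> (X, x, y) \<and>
            X \<subseteq> X' \<and> {x..y} \<subseteq> {x'..y'})"

text \<open>Loop state of the algorithm: the sets \<open>S\<close>, \<open>R\<close>, \<open>M\<close>.\<close>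

type_synonym 'v state = "'v timed_set set \<times> 'v timed_set set \<times> 'v timed_set set"

definition initial_sets :: "'v link set \<Rightarrow> 'v timed_set set" where
  "initial_sets E = {({u, v}, b, b) | b e u v. (b, e, u, v) \<in> E}"

definition initial_state :: "'v link set \<Rightarrow> 'v state" where
  "initial_state E = (initial_sets E, {}, initial_sets E)"

text \<open>Within the body of the main loop, a triple \<open>(S, M, isMax)\<close> is threaded through.\<close>

fun add_candidate ::
  "'v timed_set \<Rightarrow> 'v timed_set set \<times> 'v timed_set set \<times> bool
     \<Rightarrow> 'v timed_set set \<times> 'v timed_set set \<times> bool" where
  "add_candidate C (S, M, isMax) =
     (if C \<notin> M then (insert C S, insert C M, False) else (S, M, False))"

definition try_node ::
  "real set \<Rightarrow> 'v set \<Rightarrow> 'v link set \<Rightarrow> 'v timed_set \<Rightarrow> 'v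
     \<Rightarrow> 'v timed_set set \<times> 'v timed_set set \<times> bool
     \<Rightarrow> 'v timed_set set \<times> 'v timed_set set \<times> bool" where
  "try_node T V E = (\<lambda>(X, x, y) v st.
     if is_clique T V E (X \<union> {v}, x, y) then add_candidate (X \<union> {v}, x, y) st else st)"

fun latest_end :: "'v link set \<Rightarrow> 'v timed_set \<Rightarrow> real" where
  "latest_end E (X, x, y) =
     Min {e. \<exists>b u v. (b, e, u, v) \<in> E \<and> u \<in> X \<and> v \<in> X \<and> {x..y} \<subseteq> {b..e}}"

definition try_time ::
  "'v link set \<Rightarrow> 'v timed_set
     \<Rightarrow> 'v timed_set set \<times> 'v timed_set set \<times> bool
     \<Rightarrow> 'v timed_set set \<times> 'v timed_set set \<times> bool" where
  "try_time E = (\<lambda>(X, x, y) st.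
     let l = latest_end E (X, x, y) in if l \<noteq> y then add_candidate (X, x, l) st else st)"

text \<open>One iteration of the main loop. Both the element removed from \<open>S\<close> and the order \<open>vs\<close> in
  which the nodes outside \<open>X\<close> are tried are arbitrary.\<close>

inductive step :: "real set \<Rightarrow> 'v set \<Rightarrow> 'v link set \<Rightarrow> 'v state \<Rightarrow> 'v state \<Rightarrow> bool"
  for T :: "real set" and V :: "'v set" and E :: "'v link set" where
  "step T V E (S, R, M) (S', if isMax then insert (X, x, y) R else R, M')"
  if "(X, x, y) \<in> S"
    and "distinct vs" and "set vs = V - X"
    and "try_time E (X, x, y)
           (fold (try_node T V E (X, x, y)) vs (S - {(X, x, y)}, M, True)) = (S', M', isMax)"

end

theory Submission imports Defs begin

text \<open>Every timed set \<open>(X, x, y)\<close> ever stored is a clique containing the two ends of a link that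
  starts exactly at \<open>x\<close>. By simplicity that link is the only one joining its ends around time
  \<open>x\<close>, so the clique cannot be extended to the left, and it is maximal as soon as it has no
  successor, i.e. no node can be added and its right end cannot be moved. Conversely, a maximal
  clique \<open>(X, x, y)\<close> with two nodes contains a link starting at \<open>x\<close>, and it is reached from that
  link by first adding the other nodes of \<open>X\<close> at time \<open>x\<close>, then moving the right end. Each
  iteration enlarges the set \<open>M - S\<close> of processed timed sets by one element, and only finitely
  many timed sets have their ends among the link ends.\<close>

section \<open>The loop body as one set operation, independent of the order of the nodes\<close>

definition node_successors :: "real set \<Rightarrow> 'v set \<Rightarrow> 'v link set \<Rightarrow> 'v timed_set \<Rightarrow> 'v timed_set set"
  where "node_successors T V E = (\<lambda>(X, x, y).
    {(X \<union> {v}, x, y) | v. v \<in> V - X \<and> is_clique T V E (X \<union> {v}, x, y)})"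

definition time_successors :: "'v link set \<Rightarrow> 'v timed_set \<Rightarrow> 'v timed_set set"
  where "time_successors E = (\<lambda>(X, x, y).
    if latest_end E (X, x, y) \<noteq> y then {(X, x, latest_end E (X, x, y))} else {})"

definition successors :: "real set \<Rightarrow> 'v set \<Rightarrow> 'v link set \<Rightarrow> 'v timed_set \<Rightarrow> 'v timed_set set"
  where "successors T V E C = node_successors T V E C \<union> time_successors E C"

text \<open>The clique test ignores the threaded state and \<open>M\<close> absorbs repetitions, so
  the outcome depends only on \<open>set vs\<close>. The flag \<open>m\<close> and the sets are
  general so that the induction goes through.\<close>

lemma fold_try_node:
  "fold (try_node T V E (X, x, y)) vs (S, M, m) =
    (let A = {(X \<union> {v}, x, y) | v. v \<in> set vs \<and> is_clique T V E (X \<union> {v}, x, y)}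
     in (S \<union> (A - M), M \<union> A, m \<and> A = {}))"
proof (induction vs arbitrary: S M m)
  case Nil
  then show ?case by simp
next
  case (Cons w vs)
  let ?A = "\<lambda>vs. {(X \<union> {v}, x, y) | v. v \<in> set vs \<and> is_clique T V E (X \<union> {v}, x, y)}"
  show ?case
  proof (cases "is_clique T V E (X \<union> {w}, x, y)")
    case True
    then have A: "?A (w # vs) = insert (X \<union> {w}, x, y) (?A vs)"
      by (auto simp del: is_clique.simps)
    have hd: "try_node T V E (X, x, y) w (S, M, m) =
        (S \<union> ({(X \<union> {w}, x, y)} - M), M \<union> {(X \<union> {w}, x, y)}, False)"
      unfolding try_node_def split_conv if_P[OF True] by auto
    show ?thesis
      unfolding fold_Cons comp_apply hd Cons.IH Let_def A by auto
  next
    case False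
    then have A: "?A (w # vs) = ?A vs"
      by (auto simp del: is_clique.simps)
    have hd: "try_node T V E (X, x, y) w (S, M, m) = (S, M, m)"
      unfolding try_node_def split_conv if_not_P[OF False] ..
    show ?thesis
      unfolding fold_Cons comp_apply hd Cons.IH Let_def A by simp
  qed
qed

lemma try_time_eq:
  "try_time E (X, x, y) (S, M, m) =
    (S \<union> (time_successors E (X, x, y) - M), M \<union> time_successors E (X, x, y),
     m \<and> time_successors E (X, x, y) = {})"
  by (auto simp: try_time_def time_successors_def Let_def)

text \<open>\<open>try_time\<close> filters against the already enlarged \<open>M\<close>. What this
  additionally discards is a node successor outside the old \<open>M\<close>, hence already in
  \<open>S\<close>, so filtering all successors against the old \<open>M\<close> gives the same
  sets.\<close>

lemma loop_body_eq:
  assumes "set vs = V - X"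
  shows "try_time E (X, x, y) (fold (try_node T V E (X, x, y)) vs (S, M, True)) =
    (S \<union> (successors T V E (X, x, y) - M), M \<union> successors T V E (X, x, y),
     successors T V E (X, x, y) = {})"
proof -
  have A: "{(X \<union> {v}, x, y) | v. v \<in> set vs \<and> is_clique T V E (X \<union> {v}, x, y)}
      = node_successors T V E (X, x, y)"
    using assms by (simp add: node_successors_def)
  show ?thesis
    unfolding fold_try_node A Let_def try_time_eq successors_def by auto
qed

text \<open>Of the two arbitrary choices in an iteration, only that of the removed element affects
  the result.\<close>

lemma stepE:
  assumes "step T V E (S, R, M) s'"
  obtains C where "C \<in> S"
    "s' = (S - {C} \<union> (successors T V E C - M),
           if successors T V E C = {} then insert C R else R, M \<union> successors T V E C)"
  using assms
proof cases
  case (1 X x y vs S' M' isMax)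
  then show thesis
    using that[of "(X, x, y)"] loop_body_eq[of vs V X E x y T "S - {(X, x, y)}" M] by auto
qed

lemma step_exists:
  assumes "finite V" "C \<in> S"
  shows "\<exists>s'. step T V E (S, R, M) s'"
proof -
  obtain X x y where C: "C = (X, x, y)" by (cases C)
  obtain vs where "set vs = V - X" "distinct vs"
    using finite_distinct_list[of "V - X"] assms(1) by auto
  then show ?thesis
    using step.intros[OF assms(2)[unfolded C] _ _ loop_body_eq] by blast
qed

section \<open>Cliques in a simple link stream and how their time intervals can grow\<close>

locale simple_link_stream =
  fixes T :: "real set" and V :: "'v set" and E :: "'v link set"
  assumes stream: "link_stream T V E" and undir: "undirected E" and simple_links: "simple E"
begin

lemma finite_nodes: "finite V" and finite_links: "finite E"
  using stream by (auto simp: link_stream_def)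

lemma linkD:
  assumes "(b, e, u, v) \<in> E"
  shows "b \<le> e" "{b..e} \<subseteq> T" "u \<in> V" "v \<in> V" "u \<noteq> v"
proof -
  show "b \<le> e" "u \<in> V" "v \<in> V" "u \<noteq> v"
    using assms stream simple_links by (auto simp: link_stream_def simple_def)
  have "b \<in> T" "e \<in> T" "is_interval T"
    using assms stream by (auto simp: link_stream_def)
  then show "{b..e} \<subseteq> T"
    unfolding is_interval_1 subset_iff atLeastAtMost_iff by blast
qed

lemma link_unique:
  assumes "(b, e, u, v) \<in> E" "(b', e', u, v) \<in> E" "t \<in> {b..e}" "t \<in> {b'..e'}"
  shows "b' = b \<and> e' = e"
  using simple_links assms unfolding simple_def by blast

lemma clique_link:
  assumes "is_clique T V E (X, x, y)" "u \<in> X" "v \<in> X" "u \<noteq> v"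
  obtains b e where "(b, e, u, v) \<in> E" "{x..y} \<subseteq> {b..e}"
  using assms unfolding is_clique.simps by blast

lemma clique_restrict:
  assumes "is_clique T V E (X, x, y)" "X' \<subseteq> X" "x \<le> x'" "x' \<le> y'" "y' \<le> y"
  shows "is_clique T V E (X', x', y')"
proof -
  have "{x'..y'} \<subseteq> {x..y}" using assms(3,5) by simp
  then show ?thesis
    using assms(1,2,4) unfolding is_clique.simps by (meson order_trans subsetD)
qed

text \<open>The right end does not occur in the condition, so anchoring survives every move of
  it.\<close>

definition anchored :: "'v timed_set \<Rightarrow> bool" where
  "anchored = (\<lambda>(X, x, y). \<exists>e u v. (x, e, u, v) \<in> E \<and> u \<in> X \<and> v \<in> X)"

text \<open>The anchoring link and the link that the larger clique requires between the same two
  nodes both contain time \<open>x\<close>. Simplicity identifies them, so the larger interval lies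
  in a link beginning at \<open>x\<close>.\<close>

lemma anchored_left_end:
  assumes "anchored (X, x, y)" "x \<le> y" "is_clique T V E (X', x', y')" "X \<subseteq> X'" "{x..y} \<subseteq> {x'..y'}"
  shows "x' = x"
proof -
  obtain e u v where l: "(x, e, u, v) \<in> E" "u \<in> X" "v \<in> X"
    using assms(1) by (auto simp: anchored_def)
  then obtain b' e' where l': "(b', e', u, v) \<in> E" "{x'..y'} \<subseteq> {b'..e'}"
    using clique_link[OF assms(3)] assms(4) linkD(5)[OF l(1)] by blast
  have x: "x' \<le> x" "x \<le> y'" using assms(2,5) by auto
  then have "b' = x"
    using link_unique[OF l(1) l'(1), of x] l'(2) linkD(1)[OF l(1)] by auto
  then show ?thesis using l'(2) x by auto
qed

text \<open>For each pair in \<open>X\<close>, the link covering the interval has its end among the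
  candidates, hence at or after their minimum \<open>l\<close>. Anchoring supplies a pair of
  distinct nodes, so that the minimum is over a nonempty set.\<close>

lemma latest_end:
  fixes X :: "'v set" and x y :: real
  defines "l \<equiv> latest_end E (X, x, y)"
  assumes "is_clique T V E (X, x, y)" "anchored (X, x, y)"
  shows "y \<le> l" "is_clique T V E (X, x, l)" "l \<in> (fst \<circ> snd) ` E"
    and "\<And>y'. is_clique T V E (X, x, y') \<Longrightarrow> y \<le> y' \<Longrightarrow> y' \<le> l"
proof -
  let ?N = "{e. \<exists>b u v. (b, e, u, v) \<in> E \<and> u \<in> X \<and> v \<in> X \<and> {x..y} \<subseteq> {b..e}}"
  have l_def': "l = Min ?N" by (simp add: l_def)
  have sub: "?N \<subseteq> (fst \<circ> snd) ` E" by force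
  then have fin: "finite ?N" using finite_links finite_surj by blast
  have xy: "x \<le> y" using assms(2) by simp
  obtain e u v where l: "(x, e, u, v) \<in> E" "u \<in> X" "v \<in> X"
    using assms(3) by (auto simp: anchored_def)
  obtain b' e' where "(b', e', u, v) \<in> E" "{x..y} \<subseteq> {b'..e'}"
    using clique_link[OF assms(2) l(2,3) linkD(5)[OF l(1)]] .
  then have ne: "?N \<noteq> {}" using l by blast
  have lN: "l \<in> ?N" unfolding l_def' using Min_in[OF fin ne] .
  then show "l \<in> (fst \<circ> snd) ` E" using sub by blast
  show yl: "y \<le> l" using lN xy by auto
  obtain b u v where lk: "(b, l, u, v) \<in> E" "{x..y} \<subseteq> {b..l}" using lN by blast
  then have "{x..l} \<subseteq> {b..l}" using xy by auto
  then have "{x..l} \<subseteq> T" using linkD(2)[OF lk(1)] by blast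
  moreover have "\<exists>b e. (b, e, u, v) \<in> E \<and> {x..l} \<subseteq> {b..e}" if uv: "u \<in> X" "v \<in> X" "u \<noteq> v" for u v
  proof -
    obtain b e where be: "(b, e, u, v) \<in> E" "{x..y} \<subseteq> {b..e}"
      using clique_link[OF assms(2) uv] .
    then have "l \<le> e" unfolding l_def' using fin uv by (intro Min_le) blast+
    then have "{x..l} \<subseteq> {b..e}" using be(2) xy by auto
    then show ?thesis using be by blast
  qed
  ultimately show "is_clique T V E (X, x, l)" using assms(2) xy yl by simp
  fix y' assume y': "is_clique T V E (X, x, y')" "y \<le> y'"
  \<comment> \<open>A link attaining the minimum is the only one between its ends that contains time
    \<open>x\<close>, so it bounds every clique on \<open>X\<close> starting at
    \<open>x\<close>.\<close>
  obtain b u v where lk: "(b, l, u, v) \<in> E" "u \<in> X" "v \<in> X" "{x..y} \<subseteq> {b..l}" using lN by blast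
  obtain b' e' where lk': "(b', e', u, v) \<in> E" "{x..y'} \<subseteq> {b'..e'}"
    using clique_link[OF y'(1) lk(2,3) linkD(5)[OF lk(1)]] .
  have "e' = l"
    using link_unique[OF lk(1) lk'(1), of x] lk(4) lk'(2) xy y'(2) by auto
  then show "y' \<le> l" using lk'(2) xy y'(2) by auto
qed

section \<open>Anchored cliques with times among the link ends, and their relation to
  maximality\<close>

definition link_ends :: "real set" where
  "link_ends = fst ` E \<union> (fst \<circ> snd) ` E"

definition good :: "'v timed_set \<Rightarrow> bool" where
  "good C \<longleftrightarrow> is_clique T V E C \<and> anchored C \<and> C \<in> Pow V \<times> link_ends \<times> link_ends"

lemma finite_good: "finite (Collect good)"
proof (rule finite_subset)
  show "Collect good \<subseteq> Pow V \<times> link_ends \<times> link_ends"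
    by (auto simp: good_def)
  show "finite (Pow V \<times> link_ends \<times> link_ends)"
    using finite_nodes finite_links by (simp add: link_ends_def)
qed

lemma good_initial:
  assumes "C \<in> initial_sets E"
  shows "good C"
proof -
  obtain b e u v where C: "C = ({u, v}, b, b)" and l: "(b, e, u, v) \<in> E"
    using assms by (auto simp: initial_sets_def)
  \<comment> \<open>\<open>is_clique\<close> ranges over ordered pairs, so the reversed link is
    required as well.\<close>
  have l': "(b, e, v, u) \<in> E" using l undir by (auto simp: undirected_def)
  have "is_clique T V E C" using l l' linkD[OF l] by (auto simp: C)
  moreover have "anchored C" using l by (auto simp: C anchored_def)
  moreover have "b \<in> link_ends" using l by (force simp: link_ends_def)
  ultimately show ?thesis using linkD[OF l] by (simp add: good_def C)
qed

lemma good_successor: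
  assumes "good C" "D \<in> successors T V E C"
  shows "good D"
proof -
  obtain X x y where C: "C = (X, x, y)" by (cases C)
  have cl: "is_clique T V E (X, x, y)" "anchored (X, x, y)" "X \<subseteq> V" "x \<in> link_ends" "y \<in> link_ends"
    using assms(1) by (auto simp: good_def C)
  from assms(2) consider "D \<in> node_successors T V E (X, x, y)" | "D \<in> time_successors E (X, x, y)"
    by (auto simp: successors_def C)
  then show ?thesis
  proof cases
    case 1
    then obtain v where "D = (X \<union> {v}, x, y)" "v \<in> V" "is_clique T V E (X \<union> {v}, x, y)"
      by (auto simp: node_successors_def)
    then show ?thesis using cl by (auto simp: good_def anchored_def)
  next
    case 2
    then have "D = (X, x, latest_end E (X, x, y))"
      by (auto simp: time_successors_def split: if_splits)
    then show ?thesis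
      using cl latest_end[OF cl(1,2)] by (simp add: good_def anchored_def link_ends_def)
  qed
qed

text \<open>Anchoring fixes the left end of a larger clique, and \<open>latest_end\<close> its right
  end. An extra node would, after restriction to \<open>X\<close> plus that node on the old
  interval, yield a node successor.\<close>

lemma good_terminal_maximal:
  assumes "good (X, x, y)" "successors T V E (X, x, y) = {}"
  shows "is_maximal_clique T V E (X, x, y)" "card X \<ge> 2"
proof -
  have cl: "is_clique T V E (X, x, y)" "anchored (X, x, y)" "X \<subseteq> V" "x \<le> y"
    using assms(1) by (auto simp: good_def)
  have ns: "v \<notin> V - X \<or> \<not> is_clique T V E (X \<union> {v}, x, y)" for v
    using assms(2) by (auto simp: successors_def node_successors_def)
  have ts: "latest_end E (X, x, y) = y"
    using assms(2) by (auto simp: successors_def time_successors_def split: if_splits)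
  have "(X', x', y') = (X, x, y)"
    if C': "is_clique T V E (X', x', y')" "X \<subseteq> X'" "{x..y} \<subseteq> {x'..y'}" for X' x' y'
  proof -
    have x: "x' = x" using anchored_left_end[OF cl(2,4) C'] .
    have y: "y \<le> y'" using C'(3) cl(4) by auto
    have X: "X' = X"
    proof (rule ccontr)
      assume "X' \<noteq> X"
      then obtain v where v: "v \<in> X'" "v \<notin> X" using C'(2) by blast
      moreover have "v \<in> V" using v C'(1) by auto
      moreover have "is_clique T V E (X \<union> {v}, x, y)"
        using clique_restrict[OF C'(1), of "X \<union> {v}" x y] v C'(2) x y cl(4) by blast
      ultimately show False using ns by blast
    qed
    have "y' \<le> y" using latest_end(4)[OF cl(1,2) _ y] C'(1) unfolding x X ts by blast
    then show ?thesis using x y X by simp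
  qed
  then show "is_maximal_clique T V E (X, x, y)"
    unfolding is_maximal_clique.simps using cl(1) by blast
  obtain e u v where l: "(x, e, u, v) \<in> E" "u \<in> X" "v \<in> X"
    using cl(2) by (auto simp: anchored_def)
  then have "card {u, v} \<le> card X"
    using cl(3) finite_nodes finite_subset by (intro card_mono) auto
  then show "card X \<ge> 2" using linkD(5)[OF l(1)] by simp
qed

text \<open>Mirror image of \<open>latest_end\<close>: let \<open>m\<close> be the latest beginning
  of a link inside \<open>X\<close> covering the interval. Then \<open>X\<close> is still a clique
  from \<open>m\<close> on, and maximality forces \<open>m = x\<close>.\<close>

lemma maximal_anchored:
  assumes "is_maximal_clique T V E (X, x, y)" "card X \<ge> 2"
  shows "anchored (X, x, y)"
proof -
  have cl: "is_clique T V E (X, x, y)" "X \<subseteq> V" "x \<le> y" "{x..y} \<subseteq> T"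
    using assms(1) by auto
  let ?B = "{b. \<exists>e u v. (b, e, u, v) \<in> E \<and> u \<in> X \<and> v \<in> X \<and> {x..y} \<subseteq> {b..e}}"
  have "?B \<subseteq> fst ` E" by force
  then have fin: "finite ?B" using finite_links finite_surj by blast
  have "\<not> X \<subseteq> {u}" for u using assms(2) card_mono[of "{u}" X] by auto
  then obtain u v where uv: "u \<in> X" "v \<in> X" "u \<noteq> v" by blast
  obtain b e where "(b, e, u, v) \<in> E" "{x..y} \<subseteq> {b..e}"
    using clique_link[OF cl(1) uv] .
  then have ne: "?B \<noteq> {}" using uv by blast
  define m where "m = Max ?B"
  have "m \<in> ?B" unfolding m_def using Max_in[OF fin ne] .
  then obtain e u v where l: "(m, e, u, v) \<in> E" "u \<in> X" "v \<in> X" "{x..y} \<subseteq> {m..e}" by blast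
  have mx: "m \<le> x" "y \<le> e" using l(4) cl(3) by auto
  have "is_clique T V E (X, m, y)"
  proof -
    have "\<exists>b e. (b, e, u, v) \<in> E \<and> {m..y} \<subseteq> {b..e}" if uv: "u \<in> X" "v \<in> X" "u \<noteq> v" for u v
    proof -
      obtain b e where be: "(b, e, u, v) \<in> E" "{x..y} \<subseteq> {b..e}"
        using clique_link[OF cl(1) uv] .
      then have "b \<le> m" unfolding m_def using fin uv by (intro Max_ge) blast+
      then have "{m..y} \<subseteq> {b..e}" using be(2) cl(3) by auto
      then show ?thesis using be by blast
    qed
    moreover have "{m..y} \<subseteq> {m..e}" using mx by simp
    then have "{m..y} \<subseteq> T" using linkD(2)[OF l(1)] by blast
    ultimately show ?thesis using cl mx by simp
  qed
  moreover have "{x..y} \<subseteq> {m..y}" using mx by simp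
  ultimately have "m = x"
    using assms(1) unfolding is_maximal_clique.simps by blast
  then show ?thesis using l by (auto simp: anchored_def)
qed

section \<open>Loop invariant, termination and the returned set\<close>

definition invariant :: "'v state \<Rightarrow> bool" where
  "invariant = (\<lambda>(S, R, M). S \<subseteq> M \<and> initial_sets E \<subseteq> M \<and> M \<subseteq> Collect good \<and>
     (\<forall>C \<in> M - S. successors T V E C \<subseteq> M) \<and> R = {C \<in> M - S. successors T V E C = {}})"

lemma invariant_initial: "invariant (initial_state E)"
  using good_initial by (auto simp: invariant_def initial_state_def)

text \<open>Elements entering \<open>S\<close> are new to \<open>M\<close>, so no processed element
  becomes pending again, and \<open>C\<close> is the only one that becomes processed.\<close>

lemma invariant_step:
  assumes "invariant s" "step T V E s s'"
  shows "invariant s'"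
proof -
  obtain S R M where s: "s = (S, R, M)" by (cases s)
  obtain C where C: "C \<in> S" "s' = (S - {C} \<union> (successors T V E C - M),
      if successors T V E C = {} then insert C R else R, M \<union> successors T V E C)"
    using stepE assms(2) unfolding s by blast
  have inv: "S \<subseteq> M" "initial_sets E \<subseteq> M" "M \<subseteq> Collect good"
    "\<forall>C \<in> M - S. successors T V E C \<subseteq> M" "R = {C \<in> M - S. successors T V E C = {}}"
    using assms(1) by (auto simp: invariant_def s)
  have "successors T V E C \<subseteq> Collect good" using good_successor inv C(1) by blast
  then show ?thesis
    unfolding C(2) invariant_def split_conv
    using inv C(1) by (intro conjI) (auto split: if_splits)
qed

lemma invariant_termip:
  assumes "invariant s"
  shows "termip (step T V E) s"
  using assms
proof (induction "card (Collect good - (case s of (S, R, M) \<Rightarrow> M - S))" arbitrary: s rule: less_induct)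
  case less
  obtain S R M where s: "s = (S, R, M)" by (cases s)
  show ?case
  proof (rule accp.intros)
    fix s' assume "(step T V E)\<inverse>\<inverse> s' s"
    then have st: "step T V E s s'" by simp
    obtain C where C: "C \<in> S" "s' = (S - {C} \<union> (successors T V E C - M),
        if successors T V E C = {} then insert C R else R, M \<union> successors T V E C)"
      using stepE st unfolding s by blast
    have inv: "S \<subseteq> M" "M \<subseteq> Collect good"
      using less.prems by (auto simp: invariant_def s)
    have "card (Collect good - (case s' of (S, R, M) \<Rightarrow> M - S)) <
        card (Collect good - (case s of (S, R, M) \<Rightarrow> M - S))"
    proof (rule psubset_card_mono)
      show "finite (Collect good - (case s of (S, R, M) \<Rightarrow> M - S))"
        using finite_good by simp
      \<comment> \<open>\<open>C\<close> witnesses strictness: it was pending, and being in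
        \<open>M\<close> it is not put back into \<open>S\<close>.\<close>
      have "C \<in> Collect good - (M - S)" "C \<notin> Collect good - (M \<union> successors T V E C -
          (S - {C} \<union> (successors T V E C - M)))"
        using C(1) inv by auto
      then show "Collect good - (case s' of (S, R, M) \<Rightarrow> M - S) \<subset>
          Collect good - (case s of (S, R, M) \<Rightarrow> M - S)"
        unfolding s C(2) split_conv by blast
    qed
    then show "termip (step T V E) s'"
      using less.hyps invariant_step[OF less.prems st] by blast
  qed
qed

text \<open>Only closure of \<open>M\<close> under successors is assumed, so the argument follows
  one convenient path, whatever order the algorithm took.\<close>

lemma maximal_reached:
  assumes M: "initial_sets E \<subseteq> M" "\<And>C. C \<in> M \<Longrightarrow> successors T V E C \<subseteq> M"
    and max: "is_maximal_clique T V E (X, x, y)" "card X \<ge> 2"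
  shows "(X, x, y) \<in> M" "successors T V E (X, x, y) = {}"
proof -
  have cl: "is_clique T V E (X, x, y)" "X \<subseteq> V" "x \<le> y" using max by auto
  have maxD: "X' = X \<and> y' = y" if "is_clique T V E (X', x, y')" "X \<subseteq> X'" "y \<le> y'" for X' y'
    using max(1) that unfolding is_maximal_clique.simps by (metis Pair_inject atLeastatMost_subset_iff order_refl)
  have anc: "anchored (X, x, z)" for z
    using maximal_anchored[OF max] by (simp add: anchored_def)
  then obtain e u v where l: "(x, e, u, v) \<in> E" "u \<in> X" "v \<in> X"
    by (auto simp: anchored_def)
  have clx: "is_clique T V E (X', x, x)" if "X' \<subseteq> X" for X'
    using clique_restrict[OF cl(1) that order_refl order_refl cl(3)] .
  have "finite X" using cl(2) finite_nodes finite_subset by blast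
  then have fin: "finite (X - {u, v})" by simp
  \<comment> \<open>\<open>W\<close> collects the nodes already added to the anchoring link. Each
    intermediate set is a clique at time \<open>x\<close> as a subset of \<open>X\<close>.\<close>
  have "({u, v} \<union> W, x, x) \<in> M" if "finite W" "W \<subseteq> X - {u, v}" for W
    using that
  proof (induction W rule: finite_induct)
    case empty
    have "({u, v}, x, x) \<in> initial_sets E" using l(1) by (auto simp: initial_sets_def)
    then show ?case using M(1) by auto
  next
    case (insert w W)
    have "({u, v} \<union> W \<union> {w}, x, x) \<in> successors T V E ({u, v} \<union> W, x, x)"
      unfolding successors_def node_successors_def split_conv
      using insert.prems insert.hyps cl(2) l clx[of "{u, v} \<union> W \<union> {w}"] by blast
    then have "({u, v} \<union> W \<union> {w}, x, x) \<in> M" using M(2) insert by blast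
    then show ?case by (simp add: insert_commute)
  qed
  from this[OF fin] have "({u, v} \<union> (X - {u, v}), x, x) \<in> M"
    by simp
  moreover have "{u, v} \<union> (X - {u, v}) = X" using l by blast
  ultimately have start: "(X, x, x) \<in> M" by simp
  \<comment> \<open>A single time move suffices: the clique on \<open>[x, y]\<close> shows that it
    reaches \<open>y\<close>, and maximality that it does not go beyond.\<close>
  have "y \<le> latest_end E (X, x, x)"
    using latest_end(4)[OF clx anc cl(1,3)] by simp
  then have lx: "latest_end E (X, x, x) = y"
    using maxD latest_end(2)[OF clx anc] by blast
  show "(X, x, y) \<in> M"
  \<comment> \<open>If \<open>x = y\<close>, there is no time successor and the starting set is
    already the goal.\<close>
  proof (cases "x = y")
    case False
    then have "(X, x, y) \<in> successors T V E (X, x, x)"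
      unfolding successors_def time_successors_def split_conv lx by simp
    then show ?thesis using M(2)[OF start] by blast
  qed (use start in simp)
  have "node_successors T V E (X, x, y) = {}"
    using maxD by (fastforce simp: node_successors_def simp del: is_clique.simps)
  moreover have "latest_end E (X, x, y) = y"
    using maxD latest_end(1,2)[OF cl(1) anc] by blast
  ultimately show "successors T V E (X, x, y) = {}"
    by (simp add: successors_def time_successors_def del: latest_end.simps)
qed

text \<open>With nothing pending, every element of \<open>M\<close> is processed, so the invariant
  makes \<open>M\<close> closed under successors.\<close>

lemma invariant_result:
  assumes "invariant ({}, R, M)"
  shows "R = {(X, x, y). is_maximal_clique T V E (X, x, y) \<and> card X \<ge> 2}"
proof -
  have inv: "initial_sets E \<subseteq> M" "M \<subseteq> Collect good" "\<And>C. C \<in> M \<Longrightarrow> successors T V E C \<subseteq> M"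
    and R: "R = {C \<in> M. successors T V E C = {}}"
    using assms by (auto simp: invariant_def)
  have "(X, x, y) \<in> R \<longleftrightarrow> is_maximal_clique T V E (X, x, y) \<and> card X \<ge> 2" for X x y
    using good_terminal_maximal[of X x y] maximal_reached[OF inv(1,3), of X x y] inv(2)
    unfolding R by blast
  then show ?thesis by (simp add: set_eq_iff del: is_maximal_clique.simps)
qed

end

theorem mainTheorem1:
  fixes T :: "real set" and V :: "'v set" and E :: "'v link set"
  assumes "link_stream T V E" and "undirected E" and "simple E"
  shows "termip (step T V E) (initial_state E) \<and>
         (\<forall>S R M. (step T V E)\<^sup>*\<^sup>* (initial_state E) (S, R, M) \<longrightarrow>
            \<not> (\<exists>s'. step T V E (S, R, M) s') \<longrightarrow>
            S = {} \<and> R = {(X, x, y). is_maximal_clique T V E (X, x, y) \<and> card X \<ge> 2})"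
proof -
  interpret simple_link_stream T V E
    using assms by unfold_locales
  have inv: "invariant s" if "(step T V E)\<^sup>*\<^sup>* (initial_state E) s" for s
    using that by induction (auto intro: invariant_initial invariant_step)
  show ?thesis
  proof (intro conjI allI impI)
    show "termip (step T V E) (initial_state E)"
      using invariant_termip invariant_initial .
    fix S R M
    assume reach: "(step T V E)\<^sup>*\<^sup>* (initial_state E) (S, R, M)"
      and stuck: "\<not> (\<exists>s'. step T V E (S, R, M) s')"
    \<comment> \<open>A pending element would allow another iteration, since the finitely many nodes
      outside it can be listed.\<close>
    show "S = {}"
      using step_exists[OF finite_nodes] stuck by blast
    then show "R = {(X, x, y). is_maximal_clique T V E (X, x, y) \<and> card X \<ge> 2}"
      using invariant_result inv[OF reach] by blast
  qed
qed

end
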